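(* Let $1\le p\le\infty$, $m\in\mathbb{N}$, $n_1,\ldots,n_m\in\mathbb{N}$ (positive integers), let $Q_i=2n_i+2$ for $1\le i\le m$, and let $\varphi:[0,1]^m\to[0,\infty)$ be a nonnegative measurable function. Then the weighted Hardy operator $\mathcal{P}_{\varphi,m}$ is bounded on $L^p(\mathbb{H}^{n_1}\times\mathbb{H}^{n_2}\times\cdots\times\mathbb{H}^{n_m})$ if and only if $$\int_0^1\cdots\int_0^1 t_1^{-Q_1/p}\cdots t_m^{-Q_m/p}\,\varphi(t_1,\ldots,t_m)\,dt_1\cdots dt_m<\infty,$$ where $Q_i/p$ is read as $0$ when $p=\infty$.
   Context: For a positive integer $n$, the Heisenberg group $\mathbb{H}^n$ is the manifold $\mathbb{R}^{2n+1}$ with group law $$x\circ y=\Big(x_1+y_1,\ldots,x_{2n}+y_{2n},\,x_{2n+1}+y_{2n+1}+2\sum_{j=1}^n(y_jx_{n+j}-x_jy_{n+j})\Big),$$ with Haar measure equal to Lebesgue measure on $\mathbb{R}^{2n+1}$, dilations $$\delta_r(x_1,\ldots,x_{2n},x_{2n+1})=(rx_1,\ldots,rx_{2n},r^2x_{2n+1}),\quad r>0,$$ and homogeneous dimension $Q=2n+2$. The product $\mathbb{H}^{n_1}\times\cdots\times\mathbb{H}^{n_m}$ carries the product (Lebesgue) measure. For a nonnegative measurable function $f$ on $\mathbb{H}^{n_1}\times\cdots\times\mathbb{H}^{n_m}$, the weighted Hardy operator is $$\mathcal{P}_{\varphi,m}(f)(x)=\int_0^1\cdots\int_0^1 f(\delta_{t_1}x_1,\ldots,\delta_{t_m}x_m)\,\varphi(t_1,\ldots,t_m)\,dt_1\cdots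 dt_m,$$ for $x=(x_1,\ldots,x_m)\in\mathbb{H}^{n_1}\times\cdots\times\mathbb{H}^{n_m}$ (with value in $[0,\infty]$), where $\delta_{t_i}$ acts on $\mathbb{H}^{n_i}$. Boundedness on $L^p$ means that there is a finite constant $C$ with $\|\mathcal{P}_{\varphi,m}(f)\|_{L^p}\le C\|f\|_{L^p}$ for every nonnegative $f\in L^p(\mathbb{H}^{n_1}\times\cdots\times\mathbb{H}^{n_m})$. *)

theory Defs
  imports "HOL-Analysis.Analysis" "HOL-Probability.Essential_Supremum"
begin

text \<open>
  A point of the Heisenberg group of index n is a coordinate vector in
  \<open>{1..2*n+1} \<rightarrow>\<^sub>E UNIV\<close>; the dimension is a term rather than a type because the indices
  of the factors of a product of Heisenberg groups vary independently.  A point of the product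
  of \<open>m\<close> such groups is a family \<open>x\<close> with \<open>x i\<close> the \<open>i\<close>-th component and \<open>x i j\<close> its
  \<open>j\<close>-th coordinate.
\<close>

definition heis_space :: "nat \<Rightarrow> (nat \<Rightarrow> real) set" where
  "heis_space n = {1..2*n+1} \<rightarrow>\<^sub>E UNIV"

definition heis_mult :: "nat \<Rightarrow> (nat \<Rightarrow> real) \<Rightarrow> (nat \<Rightarrow> real) \<Rightarrow> (nat \<Rightarrow> real)" where
  "heis_mult n x y =
     (\<lambda>j\<in>{1..2*n+1}. if j = 2*n+1
        then x j + y j + 2 * (\<Sum>k=1..n. y k * x (n+k) - x k * y (n+k))
        else x j + y j)"

definition heis_dilation :: "nat \<Rightarrow> real \<Rightarrow> (nat \<Rightarrow> real) \<Rightarrow> (nat \<Rightarrow> real)" where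
  "heis_dilation n r x = (\<lambda>j\<in>{1..2*n+1}. if j = 2*n+1 then r\<^sup>2 * x j else r * x j)"

definition heis_hdim :: "nat \<Rightarrow> nat" where
  "heis_hdim n = 2*n + 2"

text \<open>The group law enters the results below only through its Haar measure and the dilations,
  which are automorphisms.\<close>

lemma heis_mult_closed: "heis_mult n x y \<in> heis_space n"
  by (simp add: heis_mult_def heis_space_def)

lemma heis_dilation_closed: "heis_dilation n r x \<in> heis_space n"
  by (simp add: heis_dilation_def heis_space_def)

lemma heis_dilation_mult:
  "heis_dilation n r (heis_mult n x y) = heis_mult n (heis_dilation n r x) (heis_dilation n r y)"
proof -
  have "(\<Sum>k=1..n. heis_dilation n r y k * heis_dilation n r x (n+k)
          - heis_dilation n r x k * heis_dilation n r y (n+k))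
      = (\<Sum>k=1..n. r\<^sup>2 * (y k * x (n+k) - x k * y (n+k)))"
    by (intro sum.cong) (auto simp: heis_dilation_def power2_eq_square algebra_simps)
  then have eq: "(\<Sum>k=1..n. heis_dilation n r y k * heis_dilation n r x (n+k)
          - heis_dilation n r x k * heis_dilation n r y (n+k))
      = r\<^sup>2 * (\<Sum>k=1..n. y k * x (n+k) - x k * y (n+k))"
    by (simp only: sum_distrib_left)
  show ?thesis
  proof
    fix j
    show "heis_dilation n r (heis_mult n x y) j
        = heis_mult n (heis_dilation n r x) (heis_dilation n r y) j"
      unfolding heis_mult_def[of n "heis_dilation n r x"] eq
      by (auto simp: heis_dilation_def heis_mult_def algebra_simps)
  qed
qed

text \<open>Measures are completed, so that \<open>borel_measurable\<close> with respect to them means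
  Lebesgue measurable.\<close>

definition heis_prod_lebesgue :: "nat \<Rightarrow> (nat \<Rightarrow> nat) \<Rightarrow> (nat \<Rightarrow> nat \<Rightarrow> real) measure" where
  "heis_prod_lebesgue m n =
     completion (PiM {1..m} (\<lambda>i. PiM {1..2 * n i + 1} (\<lambda>_. lborel)))"

definition cube_lebesgue :: "nat \<Rightarrow> (nat \<Rightarrow> real) measure" where
  "cube_lebesgue m = completion (PiM {1..m} (\<lambda>_. restrict_space lborel {0..1}))"

lemma space_heis_prod_lebesgue:
  "space (heis_prod_lebesgue m n) = (\<Pi>\<^sub>E i\<in>{1..m}. heis_space (n i))"
  by (simp add: heis_prod_lebesgue_def heis_space_def space_PiM)

lemma space_cube_lebesgue: "space (cube_lebesgue m) = {1..m} \<rightarrow>\<^sub>E {0..1}"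
  by (simp add: cube_lebesgue_def space_PiM space_restrict_space)

definition prod_dilation ::
  "nat \<Rightarrow> (nat \<Rightarrow> nat) \<Rightarrow> (nat \<Rightarrow> real) \<Rightarrow> (nat \<Rightarrow> nat \<Rightarrow> real) \<Rightarrow> (nat \<Rightarrow> nat \<Rightarrow> real)" where
  "prod_dilation m n t x = (\<lambda>i\<in>{1..m}. heis_dilation (n i) (t i) (x i))"

definition weighted_hardy ::
  "nat \<Rightarrow> (nat \<Rightarrow> nat) \<Rightarrow> ((nat \<Rightarrow> real) \<Rightarrow> real) \<Rightarrow> ((nat \<Rightarrow> nat \<Rightarrow> real) \<Rightarrow> real)
     \<Rightarrow> (nat \<Rightarrow> nat \<Rightarrow> real) \<Rightarrow> ennreal" where
  "weighted_hardy m n \<phi> f x =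
     (\<integral>\<^sup>+ t. ennreal (f (prod_dilation m n t x) * \<phi> t) \<partial>cube_lebesgue m)"

definition ennreal_powr :: "ennreal \<Rightarrow> real \<Rightarrow> ennreal" where
  "ennreal_powr a s = (if a = \<infinity> then \<infinity> else ennreal (enn2real a powr s))"
  \<comment> \<open>only meant for \<open>s > 0\<close>\<close>

definition Lp_norm :: "'a measure \<Rightarrow> ennreal \<Rightarrow> ('a \<Rightarrow> ennreal) \<Rightarrow> ennreal" where
  "Lp_norm M p g =
     (if p = \<infinity> then esssup M g
      else ennreal_powr (\<integral>\<^sup>+ x. ennreal_powr (g x) (enn2real p) \<partial>M) (1 / enn2real p))"

definition nonneg_Lp :: "'a measure \<Rightarrow> ennreal \<Rightarrow> ('a \<Rightarrow> real) set" where
  "nonneg_Lp M p =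
     {f \<in> borel_measurable M. (\<forall>x\<in>space M. 0 \<le> f x) \<and> Lp_norm M p (\<lambda>x. ennreal (f x)) < \<infinity>}"

definition Lp_bounded :: "'a measure \<Rightarrow> ennreal \<Rightarrow> (('a \<Rightarrow> real) \<Rightarrow> 'a \<Rightarrow> ennreal) \<Rightarrow> bool" where
  "Lp_bounded M p T \<longleftrightarrow>
     (\<exists>C::real. 0 \<le> C \<and>
        (\<forall>f\<in>nonneg_Lp M p. Lp_norm M p (T f) \<le> ennreal C * Lp_norm M p (\<lambda>x. ennreal (f x))))"

text \<open>When an integrand contains \<open>t i powr (- hdim_quotient (n i) p)\<close>, the library's
  convention \<open>0 powr s = 0\<close> matters only on the null set of those \<open>t\<close> in the cube having a zero
  coordinate.\<close>

definition hdim_quotient :: "nat \<Rightarrow> ennreal \<Rightarrow> real" where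
  "hdim_quotient n p = (if p = \<infinity> then 0 else real (heis_hdim n) / enn2real p)"

end

theory Submission
  imports Defs "HOL-Probability.Infinite_Product_Measure"
begin

text \<open>
  Write \<open>w t\<close> for the product of the \<open>t i powr (- Q i / p)\<close>.  Dilating by \<open>t\<close> multiplies the
  \<open>L\<^sup>p\<close> norm by \<open>w t\<close>.  If \<open>A\<close> is the integral of \<open>w * \<phi>\<close>, Jensen's inequality for the measure
  with density \<open>w * \<phi>\<close>, followed by Fubini, bounds the operator by \<open>A\<close>.  Conversely, a function
  that is homogeneous of the critical degree \<open>- Q i / p\<close> in each variable on the shells
  \<open>1 / b \<le> \<bar>x i\<bar> < b\<close> is an eigenfunction of the truncated operator on the smaller shells
  \<open>1 \<le> \<bar>x i\<bar> < b\<close>, and the two \<open>L\<^sup>p\<close> norms are comparable uniformly in \<open>b\<close>; let \<open>b\<close> tend to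
  infinity.  For \<open>p = \<infinity>\<close> constants serve as test functions.  The passage from Lebesgue to Borel
  measurable functions needs that almost every dilation preserves null sets.
\<close>

section \<open>Norms and the Jensen inequality\<close>

lemma measurable_ennreal_powr [measurable]: "(\<lambda>a. ennreal_powr a s) \<in> borel_measurable borel"
  unfolding ennreal_powr_def by measurable

lemma ennreal_powr_ennreal [simp]: "0 \<le> a \<Longrightarrow> ennreal_powr (ennreal a) s = ennreal (a powr s)"
  by (simp add: ennreal_powr_def)

lemma ennreal_powr_top [simp]: "ennreal_powr \<infinity> s = \<infinity>" "ennreal_powr top s = top"
  by (simp_all add: ennreal_powr_def)

lemma ennreal_powr_mono:
  assumes "0 < s" "a \<le> b"
  shows "ennreal_powr a s \<le> ennreal_powr b s"
  using assms by (cases a; cases b) (auto intro!: ennreal_leI powr_mono2 simp: top_unique)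

lemma ennreal_powr_mult:
  assumes "0 < s"
  shows "ennreal_powr (a * b) s = ennreal_powr a s * ennreal_powr b s"
proof -
  have 1: "ennreal_powr (top * b) s = top * ennreal_powr b s" for b
  proof (cases b)
    case (real r)
    then show ?thesis
      using assms by (cases "r = 0") (simp_all add: ennreal_powr_def ennreal_top_mult)
  qed simp
  show ?thesis
  proof (cases "a = top \<or> b = top")
    case True
    then show ?thesis using 1 by (metis mult.commute ennreal_powr_top(2))
  next
    case False
    then show ?thesis
      by (cases a; cases b) (simp_all add: powr_mult flip: ennreal_mult)
  qed
qed

lemma ennreal_powr_powr_inverse:
  assumes "0 < s"
  shows "ennreal_powr (ennreal_powr a s) (1 / s) = a"
  using assms by (cases a) (simp_all add: powr_powr)

text \<open>The factor \<open>c\<close> may be infinite. The necessity argument takes for it an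
  integral not yet known to be finite.\<close>

lemma Lp_norm_cmult:
  assumes "g \<in> borel_measurable M" "p \<noteq> \<infinity>" "0 < p"
  shows "Lp_norm M p (\<lambda>x. c * g x) = c * Lp_norm M p g"
proof -
  have q: "0 < enn2real p"
    using assms by (simp add: enn2real_positive_iff less_top)
  show ?thesis
    using assms(1,2) q
    by (simp add: Lp_norm_def ennreal_powr_mult nn_integral_cmult ennreal_powr_powr_inverse)
qed

lemma Lp_norm_mono:
  assumes "p \<noteq> \<infinity>" "0 < p" "AE x in M. g x \<le> h x"
  shows "Lp_norm M p g \<le> Lp_norm M p h"
proof -
  have q: "0 < enn2real p"
    using assms by (simp add: enn2real_positive_iff less_top)
  show ?thesis
    using assms q unfolding Lp_norm_def
    by (auto intro!: ennreal_powr_mono nn_integral_mono_AE elim!: eventually_mono)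
qed

section \<open>Almost everywhere equality and completed measures\<close>

text \<open>Preimages under \<open>f\<close> and \<open>g\<close> differ only inside a null set, and
  the completion contains every set that agrees almost everywhere with one of its own.\<close>

lemma borel_measurable_completion_cong_AE:
  fixes f :: "'a \<Rightarrow> 'b::topological_space"
  assumes g: "g \<in> borel_measurable M" and ae: "AE x in M. f x = g x"
  shows "f \<in> borel_measurable (completion M)"
proof (rule measurableI)
  fix A :: "'b set" assume "A \<in> sets borel"
  then have m: "g -` A \<inter> space M \<in> sets (completion M)"
    using g by (auto simp: measurable_sets)
  from m have "f -` A \<inter> space (completion M) \<in> sets (completion M)"
  proof (rule completion.in_sets_AE[rotated])
    show "AE x in completion M. (x \<in> g -` A \<inter> space M) = (x \<in> f -` A \<inter> space (completion M))"
      using ae AE_space[of M] unfolding AE_completion_iff by eventually_elim auto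
  qed auto
  then show "f -` A \<inter> space (completion M) \<in> sets (completion M)" .
qed auto

text \<open>Lets Borel representatives replace Lebesgue measurable functions in every norm.\<close>

lemma Lp_norm_completion_cong_AE:
  assumes g: "g \<in> borel_measurable M" and ae: "AE x in M. f x = g x"
  shows "Lp_norm (completion M) p f = Lp_norm M p g"
proof (cases "p = \<infinity>")
  case True
  \<comment> \<open>\<open>esssup\<close> takes a default value at nonmeasurable functions, so the
    measurability of \<open>f\<close> for the completion has to be supplied here.\<close>
  have "esssup (completion M) f = esssup (completion M) g"
    using g ae borel_measurable_completion_cong_AE[OF g ae]
    by (intro esssup_AE_cong) (auto simp: AE_completion_iff measurable_completion)
  also have "\<dots> = esssup M g"
    using g by (simp add: esssup_eq_AE measurable_completion AE_completion_iff)
  finally show ?thesis using True by (simp add: Lp_norm_def)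
next
  case False
  have "(\<integral>\<^sup>+ x. ennreal_powr (f x) s \<partial>completion M) = (\<integral>\<^sup>+ x. ennreal_powr (g x) s \<partial>M)" for s
    unfolding nn_integral_completion
    by (rule nn_integral_cong_AE) (use ae in eventually_elim, simp)
  then show ?thesis using False by (simp add: Lp_norm_def)
qed

text \<open>Convexity puts the graph of \<open>x powr q\<close> above its tangent at
  \<open>c\<close>. The point 0 is treated apart because the convexity used is that on the open
  half-line.\<close>

lemma powr_tangent_le:
  fixes c x q :: real
  assumes "0 < c" "0 \<le> x" "1 \<le> q"
  shows "q * c powr (q - 1) * x \<le> (q - 1) * c powr q + x powr q"
proof (cases "x = 0")
  case False
  then have x: "0 < x" using assms by simp
  have "((\<lambda>x. x powr q) has_real_derivative q * c powr (q - 1)) (at c within {0<..})"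
    using assms by (auto intro!: derivative_eq_intros)
  then have "q * c powr (q - 1) * (x - c) \<le> x powr q - c powr q"
    using assms x by (intro convex_on_imp_above_tangent[OF powr_convex]) (auto simp: interior_open)
  moreover have "c powr q = c * c powr (q - 1)"
    using assms by (simp add: powr_mult_base)
  ultimately show ?thesis by (simp add: algebra_simps)
qed (use assms in simp)

text \<open>Jensen's inequality, obtained by integrating the tangent line of \<open>x powr q\<close> at the mean value.\<close>

lemma nn_integral_ennreal_powr_le:
  fixes g :: "'a \<Rightarrow> real"
  assumes [measurable]: "g \<in> borel_measurable M" and g0: "\<And>x. 0 \<le> g x"
    and A: "emeasure M (space M) = ennreal A" "0 \<le> A" and q: "1 \<le> q"
  shows "ennreal_powr (\<integral>\<^sup>+ x. ennreal (g x) \<partial>M) q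
    \<le> ennreal (A powr (q - 1)) * (\<integral>\<^sup>+ x. ennreal (g x powr q) \<partial>M)"
proof (cases "A = 0")
  case True
  then have "space M \<in> null_sets M" using A by auto
  then have "AE x in M. False" by (rule AE_I') auto
  then have "(\<integral>\<^sup>+ x. ennreal (g x) \<partial>M) = (\<integral>\<^sup>+ x. 0 \<partial>M)"
    by (intro nn_integral_cong_AE) auto
  then show ?thesis using q by (simp add: ennreal_powr_def)
next
  case False
  then have A0: "0 < A" using A by simp
  \<comment> \<open>The point of tangency stays free: 1 serves to show that the integral of
    \<open>g\<close> is finite, the mean value serves for the bound.\<close>
  have tan: "ennreal (q * c powr (q - 1)) * (\<integral>\<^sup>+ x. ennreal (g x) \<partial>M)
      \<le> ennreal ((q - 1) * c powr q * A) + (\<integral>\<^sup>+ x. ennreal (g x powr q) \<partial>M)" if c: "0 < c" for c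
  proof -
    have "ennreal (q * c powr (q - 1)) * (\<integral>\<^sup>+ x. ennreal (g x) \<partial>M)
        = (\<integral>\<^sup>+ x. ennreal (q * c powr (q - 1) * g x) \<partial>M)"
      using q g0 by (simp add: ennreal_mult nn_integral_cmult)
    also have "\<dots> \<le> (\<integral>\<^sup>+ x. ennreal ((q - 1) * c powr q) + ennreal (g x powr q) \<partial>M)"
      using powr_tangent_le[OF c g0 q] q by (intro nn_integral_mono) (simp add: ennreal_leI flip: ennreal_plus)
    also have "\<dots> = ennreal ((q - 1) * c powr q * A) + (\<integral>\<^sup>+ x. ennreal (g x powr q) \<partial>M)"
      using q A by (simp add: nn_integral_add ennreal_mult)
    finally show ?thesis .
  qed
  show ?thesis
  proof (cases "\<integral>\<^sup>+ x. ennreal (g x powr q) \<partial>M")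
    case top
    then show ?thesis using A0 by (simp add: ennreal_mult_top)
  next
    case (real K)
    have "(\<integral>\<^sup>+ x. ennreal (g x) \<partial>M) \<noteq> top"
    proof
      assume "(\<integral>\<^sup>+ x. ennreal (g x) \<partial>M) = top"
      then show False
        using tan[of 1] real q A by (simp add: ennreal_mult_top top_unique flip: ennreal_plus)
    qed
    then obtain I where I: "(\<integral>\<^sup>+ x. ennreal (g x) \<partial>M) = ennreal I" "0 \<le> I"
      by (cases "\<integral>\<^sup>+ x. ennreal (g x) \<partial>M") auto
    have "I powr q \<le> A powr (q - 1) * K"
    proof (cases "I = 0")
      case False
      \<comment> \<open>The mean value of \<open>g\<close>, positive since \<open>I\<close> and
        \<open>A\<close> are. At this point the tangent inequality collapses to
        \<open>c powr q * A \<le> K\<close>.\<close>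
      define c where "c = I / A"
      have c: "0 < c" using False I A0 by (simp add: c_def)
      have "ennreal (q * c powr (q - 1) * I) \<le> ennreal ((q - 1) * c powr q * A + K)"
        using tan[OF c] I real q A by (simp add: ennreal_mult)
      then have "q * (c powr (q - 1) * I) \<le> (q - 1) * (c powr q * A) + K"
        using q A real by (subst (asm) ennreal_le_iff) (auto simp: mult.assoc)
      moreover have "c powr (q - 1) * I = c powr q * A"
      proof -
        have "I = c * A" using A0 by (simp add: c_def)
        then show ?thesis using c powr_mult_base[of c "q - 1"] by (simp add: mult.commute)
      qed
      ultimately have "c powr q * A \<le> K" by (simp add: left_diff_distrib)
      then have "A powr (q - 1) * (c powr q * A) \<le> A powr (q - 1) * K"
        by (intro mult_left_mono) auto
      moreover have "A powr (q - 1) * (c powr q * A) = I powr q"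
        using A0 I powr_mult_base[of A "q - 1"] by (simp add: c_def powr_divide field_simps)
      ultimately show ?thesis by simp
    qed (use real in simp)
    then show ?thesis
      using I real by (simp add: ennreal_leI flip: ennreal_mult)
  qed
qed

section \<open>Hardy operators of dilation families\<close>

text \<open>Only the scaling behaviour of the dilations is kept: \<open>J t\<close> is the Jacobian
  of \<open>D t\<close>. The quantifier over \<open>g\<close> stands inside the one over
  \<open>t\<close>, so a single null set of parameters serves all \<open>g\<close>; it has room for
  the parameters at which the dilation degenerates.\<close>

locale dilation_family = X: sigma_finite_measure X + B: sigma_finite_measure B
  for X :: "'a measure" and B :: "'t measure" +
  fixes D :: "'t \<Rightarrow> 'a \<Rightarrow> 'a" and J :: "'t \<Rightarrow> real"
  assumes D_measurable: "(\<lambda>(t, x). D t x) \<in> B \<Otimes>\<^sub>M X \<rightarrow>\<^sub>M X"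
    and J_measurable [measurable]: "J \<in> borel_measurable B"
    and J_pos: "AE t in B. 0 < J t"
    and change_of_variables: "AE t in B. \<forall>g\<in>borel_measurable X.
      (\<integral>\<^sup>+ x. g x \<partial>X) = ennreal (J t) * (\<integral>\<^sup>+ x. g (D t x) \<partial>X)"
begin

sublocale pair_sigma_finite B X ..

definition hardy :: "('t \<Rightarrow> real) \<Rightarrow> ('a \<Rightarrow> real) \<Rightarrow> 'a \<Rightarrow> ennreal" where
  "hardy \<phi> f x = (\<integral>\<^sup>+ t. ennreal (f (D t x) * \<phi> t) \<partial>completion B)"

lemma measurable_D [measurable (raw)]:
  assumes "s \<in> M \<rightarrow>\<^sub>M B" "y \<in> M \<rightarrow>\<^sub>M X"
  shows "(\<lambda>z. D (s z) (y z)) \<in> M \<rightarrow>\<^sub>M X"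
  using measurable_compose[OF measurable_Pair[OF assms] D_measurable] by simp

lemma hardy_measurable [measurable]:
  assumes [measurable]: "f \<in> borel_measurable X" "\<phi> \<in> borel_measurable B"
  shows "hardy \<phi> f \<in> borel_measurable X"
  unfolding hardy_def nn_integral_completion by measurable

text \<open>For almost every \<open>t\<close> the change of variables, applied to the indicator of a
  null set, shows that its preimage under \<open>D t\<close> is null as well. Fubini then exchanges
  the two quantifiers.\<close>

lemma AE_D:
  assumes "AE x in X. P x"
  shows "AE x in X. AE t in B. P (D t x)"
proof -
  obtain N where N: "{x \<in> space X. \<not> P x} \<subseteq> N" "N \<in> null_sets X"
    using assms by (auto elim: AE_E simp: null_setsI)
  then have [measurable]: "N \<in> sets X" by auto
  have "AE t in B. AE x in X. D t x \<notin> N"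
    using J_pos change_of_variables AE_space
  proof eventually_elim
    case (elim t)
    note t [measurable] = elim(3)
    have "(\<integral>\<^sup>+ x. indicator N x \<partial>X) = ennreal (J t) * (\<integral>\<^sup>+ x. indicator N (D t x) \<partial>X)"
      by (intro elim(2)[rule_format]) measurable
    then have "(\<integral>\<^sup>+ x. indicator N (D t x) \<partial>X) = 0"
      using N elim(1) by (auto simp: null_setsD1)
    then have "AE x in X. (indicator N (D t x) :: ennreal) = 0"
      by (subst (asm) nn_integral_0_iff_AE) auto
    then show ?case by eventually_elim (auto simp: indicator_def split: if_splits)
  qed
  then have "AE x in X. AE t in B. D t x \<notin> N"
    by (subst AE_commute[symmetric]) auto
  then show ?thesis
  proof (rule AE_mp[OF _ AE_I2], intro impI)
    fix x assume x: "x \<in> space X" and ae: "AE t in B. D t x \<notin> N"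
    show "AE t in B. P (D t x)"
      using ae AE_space
    proof eventually_elim
      case (elim t)
      then have "D t x \<in> space X"
        using measurable_space[OF D_measurable, of "(t, x)"] x by (simp add: space_pair_measure)
      then show ?case using elim N by blast
    qed
  qed
qed

text \<open>Makes the operator well defined on almost everywhere classes, so that Borel versions of
  \<open>f\<close> and \<open>\<phi>\<close> suffice.\<close>

lemma hardy_cong_AE:
  assumes f: "AE x in X. f x = f' x" and \<phi>: "AE t in B. \<phi> t = \<phi>' t"
  shows "AE x in X. hardy \<phi> f x = hardy \<phi>' f' x"
  using AE_D[OF f]
proof eventually_elim
  case (elim x)
  then show ?case
    unfolding hardy_def nn_integral_completion
    by (intro nn_integral_cong_AE, use elim \<phi> in eventually_elim) simp
qed

section \<open>Sufficiency: a finite weight integral bounds the operator\<close>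

text \<open>The factor \<open>J t powr (1 / q)\<close> is moved from the weight to the function,
  which keeps the L^q norm of the dilated function equal to that of \<open>f\<close>. Jensen for the
  measure with density \<open>v\<close>, of total mass \<open>A\<close>, costs
  \<open>A powr (q - 1)\<close>; integrating in \<open>x\<close> first contributes one more factor
  \<open>A\<close>.\<close>

lemma nn_integral_hardy_powr_le:
  assumes [measurable]: "f \<in> borel_measurable X" "\<phi> \<in> borel_measurable B"
    and f0: "\<And>x. 0 \<le> f x" and \<phi>0: "\<And>t. 0 \<le> \<phi> t" and q: "1 \<le> q"
    and A: "(\<integral>\<^sup>+ t. ennreal (J t powr (- (1 / q)) * \<phi> t) \<partial>B) = ennreal A" "0 \<le> A"
  shows "(\<integral>\<^sup>+ x. ennreal_powr (hardy \<phi> f x) q \<partial>X)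
    \<le> ennreal (A powr q) * (\<integral>\<^sup>+ x. ennreal (f x powr q) \<partial>X)"
proof -
  define v where "v t = ennreal (J t powr (- (1 / q)) * \<phi> t)" for t
  have v [measurable]: "v \<in> borel_measurable B" unfolding v_def by measurable
  have le: "ennreal_powr (hardy \<phi> f x) q
      \<le> ennreal (A powr (q - 1)) * (\<integral>\<^sup>+ t. v t * (ennreal (J t) * ennreal (f (D t x) powr q)) \<partial>B)"
    if x [measurable]: "x \<in> space X" for x
  proof -
    have "hardy \<phi> f x = (\<integral>\<^sup>+ t. v t * ennreal (f (D t x) * J t powr (1 / q)) \<partial>B)"
      unfolding hardy_def nn_integral_completion
    proof (rule nn_integral_cong_AE, use J_pos in eventually_elim)
      case (elim t)
      then have "J t powr (- (1 / q)) * J t powr (1 / q) = 1"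
        by (simp flip: powr_add)
      then have "f (D t x) * \<phi> t = (J t powr (- (1 / q)) * \<phi> t) * (f (D t x) * J t powr (1 / q))"
        by algebra
      then show ?case by (simp add: v_def f0 \<phi>0 flip: ennreal_mult)
    qed
    also have "\<dots> = (\<integral>\<^sup>+ t. ennreal (f (D t x) * J t powr (1 / q)) \<partial>density B v)"
      by (subst nn_integral_density) auto
    finally have "ennreal_powr (hardy \<phi> f x) q
        \<le> ennreal (A powr (q - 1)) * (\<integral>\<^sup>+ t. ennreal ((f (D t x) * J t powr (1 / q)) powr q) \<partial>density B v)"
      using A q f0 by (auto intro!: nn_integral_ennreal_powr_le simp: emeasure_density v_def cong: nn_integral_cong)
    also have "(\<integral>\<^sup>+ t. ennreal ((f (D t x) * J t powr (1 / q)) powr q) \<partial>density B v)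
        = (\<integral>\<^sup>+ t. v t * ennreal ((f (D t x) * J t powr (1 / q)) powr q) \<partial>B)"
      by (subst nn_integral_density) auto
    also have "\<dots> = (\<integral>\<^sup>+ t. v t * (ennreal (J t) * ennreal (f (D t x) powr q)) \<partial>B)"
    proof (rule nn_integral_cong_AE, use J_pos in eventually_elim)
      case (elim t)
      then show ?case using q f0
        by (simp add: powr_mult powr_powr mult.commute flip: ennreal_mult)
    qed
    finally show ?thesis .
  qed
  have "(\<integral>\<^sup>+ x. ennreal_powr (hardy \<phi> f x) q \<partial>X)
      \<le> (\<integral>\<^sup>+ x. ennreal (A powr (q - 1)) * (\<integral>\<^sup>+ t. v t * (ennreal (J t) * ennreal (f (D t x) powr q)) \<partial>B) \<partial>X)"
    by (intro nn_integral_mono le)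
  also have "\<dots> = ennreal (A powr (q - 1))
      * (\<integral>\<^sup>+ x. (\<integral>\<^sup>+ t. v t * (ennreal (J t) * ennreal (f (D t x) powr q)) \<partial>B) \<partial>X)"
    by (intro nn_integral_cmult) measurable
  also have "(\<integral>\<^sup>+ x. (\<integral>\<^sup>+ t. v t * (ennreal (J t) * ennreal (f (D t x) powr q)) \<partial>B) \<partial>X)
      = (\<integral>\<^sup>+ t. (\<integral>\<^sup>+ x. v t * (ennreal (J t) * ennreal (f (D t x) powr q)) \<partial>X) \<partial>B)"
    by (rule Fubini') measurable
  also have "\<dots> = (\<integral>\<^sup>+ t. v t * (\<integral>\<^sup>+ x. ennreal (f x powr q) \<partial>X) \<partial>B)"
  proof (rule nn_integral_cong_AE, use change_of_variables AE_space in eventually_elim)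
    case (elim t)
    note t [measurable] = elim(2)
    have "(\<integral>\<^sup>+ x. ennreal (f x powr q) \<partial>X) = ennreal (J t) * (\<integral>\<^sup>+ x. ennreal (f (D t x) powr q) \<partial>X)"
      by (rule elim(1)[rule_format]) measurable
    then show ?case by (simp add: nn_integral_cmult)
  qed
  also have "\<dots> = ennreal A * (\<integral>\<^sup>+ x. ennreal (f x powr q) \<partial>X)"
    using A by (simp add: nn_integral_multc v_def)
  also have "ennreal (A powr (q - 1)) * \<dots> = ennreal (A powr q) * (\<integral>\<^sup>+ x. ennreal (f x powr q) \<partial>X)"
    using A q powr_mult_base[of A "q - 1"]
    by (cases "A = 0") (simp_all add: mult.commute flip: mult.assoc ennreal_mult)
  finally show ?thesis .
qed

text \<open>The counterpart for infinite exponent, where \<open>K\<close> will be the essential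
  supremum. By \<open>AE_D\<close> almost every \<open>x\<close> has \<open>f (D t x)\<close>
  bounded by \<open>K\<close> for almost every \<open>t\<close>.\<close>

lemma hardy_le_AE:
  assumes [measurable]: "\<phi> \<in> borel_measurable B"
    and \<phi>0: "\<And>t. 0 \<le> \<phi> t" and f: "AE x in X. ennreal (f x) \<le> K"
  shows "AE x in X. hardy \<phi> f x \<le> (\<integral>\<^sup>+ t. ennreal (\<phi> t) \<partial>B) * K"
  using AE_D[OF f]
proof eventually_elim
  case (elim x)
  have "hardy \<phi> f x \<le> (\<integral>\<^sup>+ t. ennreal (\<phi> t) * K \<partial>B)"
    unfolding hardy_def nn_integral_completion
    by (rule nn_integral_mono_AE, use elim in eventually_elim)
      (simp add: \<phi>0 ennreal_mult'' mult.commute[of "ennreal (\<phi> _)"] mult_right_mono)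
  then show ?case by (simp add: nn_integral_multc)
qed

text \<open>Borel versions of the weight and of the function reduce the claim to
  \<open>nn_integral_hardy_powr_le\<close> for finite \<open>p\<close> and to
  \<open>hardy_le_AE\<close> for infinite \<open>p\<close>. The constant obtained is the weight
  integral itself.\<close>

theorem Lp_bounded_hardyI:
  assumes p: "1 \<le> p" and \<phi>: "\<phi> \<in> borel_measurable (completion B)"
    and \<phi>0: "\<And>t. t \<in> space B \<Longrightarrow> 0 \<le> \<phi> t"
    and fin: "(\<integral>\<^sup>+ t. ennreal (J t powr (- (if p = \<infinity> then 0 else 1 / enn2real p)) * \<phi> t) \<partial>B) < \<infinity>"
      (is "nn_integral B (\<lambda>t. ennreal (J t powr (- ?e) * \<phi> t)) < \<infinity>")
  shows "Lp_bounded (completion X) p (hardy \<phi>)"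
proof -
  obtain \<phi>' where \<phi>' [measurable]: "\<phi>' \<in> borel_measurable B" and \<phi>'0: "\<And>t. 0 \<le> \<phi>' t"
    and \<phi>'eq: "AE t in B. \<phi> t = \<phi>' t"
  proof -
    obtain h where h: "h \<in> borel_measurable B" "AE t in B. \<phi> t = h t"
      using completion_ex_borel_measurable_real[OF \<phi>] by auto
    show thesis
    \<comment> \<open>Truncation at 0 makes the representative nonnegative on the whole type, not
      only on the space.\<close>
    proof (rule that[of "\<lambda>t. max 0 (h t)"])
      show "AE t in B. \<phi> t = max 0 (h t)"
        using h(2) AE_space by eventually_elim (use \<phi>0 in force)
    qed (use h in auto)
  qed
  define A where "A = enn2real (\<integral>\<^sup>+ t. ennreal (J t powr (- ?e) * \<phi>' t) \<partial>B)"
  have "(\<integral>\<^sup>+ t. ennreal (J t powr (- ?e) * \<phi> t) \<partial>B) = (\<integral>\<^sup>+ t. ennreal (J t powr (- ?e) * \<phi>' t) \<partial>B)"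
    by (rule nn_integral_cong_AE, use \<phi>'eq in eventually_elim) simp
  then have A: "(\<integral>\<^sup>+ t. ennreal (J t powr (- ?e) * \<phi>' t) \<partial>B) = ennreal A"
    using fin by (simp add: A_def)
  have A0: "0 \<le> A" by (simp add: A_def)
  have "Lp_norm (completion X) p (hardy \<phi> f) \<le> ennreal A * Lp_norm (completion X) p (\<lambda>x. ennreal (f x))"
    if f: "f \<in> nonneg_Lp (completion X) p" for f
  proof -
    obtain f' where f' [measurable]: "f' \<in> borel_measurable X" and f'0: "\<And>x. 0 \<le> f' x"
      and f'eq: "AE x in X. f x = f' x"
    proof -
      obtain h where h: "h \<in> borel_measurable X" "AE x in X. f x = h x"
        using completion_ex_borel_measurable_real f unfolding nonneg_Lp_def by blast
      show thesis
      proof (rule that[of "\<lambda>x. max 0 (h x)"])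
        show "AE x in X. f x = max 0 (h x)"
          using h(2) AE_space by eventually_elim (use f in \<open>force simp: nonneg_Lp_def\<close>)
      qed (use h in auto)
    qed
    have 1: "Lp_norm (completion X) p (hardy \<phi> f) = Lp_norm X p (hardy \<phi>' f')"
      by (intro Lp_norm_completion_cong_AE hardy_cong_AE f'eq \<phi>'eq) measurable
    have 2: "Lp_norm (completion X) p (\<lambda>x. ennreal (f x)) = Lp_norm X p (\<lambda>x. ennreal (f' x))"
      using f'eq by (intro Lp_norm_completion_cong_AE) auto
    have "Lp_norm X p (hardy \<phi>' f') \<le> ennreal A * Lp_norm X p (\<lambda>x. ennreal (f' x))"
    proof (cases "p = \<infinity>")
      case True
      \<comment> \<open>With exponent 0 the power of \<open>J t\<close> is 1 only where
        \<open>J t\<close> is nonzero, hence almost everywhere.\<close>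
      have "(\<integral>\<^sup>+ t. ennreal (\<phi>' t) \<partial>B) = ennreal A"
        unfolding A[symmetric]
        by (rule nn_integral_cong_AE, use J_pos in eventually_elim) (simp add: True)
      then have "AE x in X. hardy \<phi>' f' x \<le> ennreal A * esssup X (\<lambda>x. ennreal (f' x))"
        using hardy_le_AE[OF \<phi>' \<phi>'0 esssup_AE, of f'] by simp
      then show ?thesis
        unfolding Lp_norm_def using True by (simp add: esssup_I)
    next
      case False
      define q where "q = enn2real p"
      have q: "1 \<le> q"
        using False p by (cases p) (simp_all add: q_def)
      have "(\<integral>\<^sup>+ x. ennreal_powr (hardy \<phi>' f' x) q \<partial>X)
          \<le> ennreal (A powr q) * (\<integral>\<^sup>+ x. ennreal (f' x powr q) \<partial>X)"
        using A A0 False by (intro nn_integral_hardy_powr_le f'0 \<phi>'0 q) (auto simp: q_def)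
      then have "ennreal_powr (\<integral>\<^sup>+ x. ennreal_powr (hardy \<phi>' f' x) q \<partial>X) (1 / q)
          \<le> ennreal_powr (ennreal (A powr q) * (\<integral>\<^sup>+ x. ennreal (f' x powr q) \<partial>X)) (1 / q)"
        using q by (intro ennreal_powr_mono) auto
      then show ?thesis
        using False q A0 f'0 by (simp add: Lp_norm_def ennreal_powr_mult powr_powr flip: q_def)
    qed
    then show ?thesis unfolding 1 2 .
  qed
  then show ?thesis
    unfolding Lp_bounded_def using A0 by blast
qed

section \<open>Necessity: testing the operator on approximate eigenfunctions\<close>

text \<open>On \<open>S\<close> the image of \<open>g\<close> is at least \<open>?I * g\<close>, so
  \<open>?I\<close> times the norm of \<open>g\<close> over \<open>S\<close> is at most
  \<open>C\<close> times the full norm of \<open>g\<close>. The two norms differ at most by the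
  factor \<open>K powr (1 / enn2real p)\<close>, and the norm over \<open>S\<close> cancels.\<close>

lemma nn_integral_le_if_Lp_bounded:
  assumes \<phi> [measurable]: "\<phi> \<in> borel_measurable (completion B)"
    and \<phi>0: "\<And>t. t \<in> space B \<Longrightarrow> 0 \<le> \<phi> t"
    and p: "1 \<le> p" "p \<noteq> \<infinity>"
    and [measurable]: "g \<in> borel_measurable X" "E \<in> sets B" "S \<in> sets X" "w \<in> borel_measurable B"
    and g0: "\<And>x. 0 \<le> g x" and w0: "\<And>t. 0 \<le> w t"
    and homogeneous: "\<And>t x. t \<in> E \<Longrightarrow> x \<in> S \<Longrightarrow> w t * g x \<le> g (D t x)"
    and N: "(\<integral>\<^sup>+ x. ennreal (g x powr enn2real p) * indicator S x \<partial>X) = ennreal N" "0 < N"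
    and K: "(\<integral>\<^sup>+ x. ennreal (g x powr enn2real p) \<partial>X) \<le> ennreal (K * N)" "0 \<le> K"
    and C: "0 \<le> C" "\<And>f. f \<in> nonneg_Lp (completion X) p \<Longrightarrow>
      Lp_norm (completion X) p (hardy \<phi> f) \<le> ennreal C * Lp_norm (completion X) p (\<lambda>x. ennreal (f x))"
  shows "(\<integral>\<^sup>+ t. ennreal (w t * \<phi> t) * indicator E t \<partial>completion B) \<le> ennreal (C * K powr (1 / enn2real p))"
    (is "?I \<le> _")
proof -
  define q where "q = enn2real p"
  have q: "1 \<le> q" and p0: "0 < p"
    using p by (cases p; simp add: q_def)+
  have norm_g: "Lp_norm (completion X) p (\<lambda>x. ennreal (g x)) \<le> ennreal (K powr (1 / q) * N powr (1 / q))"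
  proof -
    have "Lp_norm (completion X) p (\<lambda>x. ennreal (g x))
        = ennreal_powr (\<integral>\<^sup>+ x. ennreal (g x powr q) \<partial>X) (1 / q)"
      using p g0 by (simp add: Lp_norm_def nn_integral_completion flip: q_def)
    also have "\<dots> \<le> ennreal_powr (ennreal (K * N)) (1 / q)"
      using K q by (intro ennreal_powr_mono) (auto simp: q_def)
    finally show ?thesis using K N by (simp add: powr_mult)
  qed
  have norm_gS: "Lp_norm (completion X) p (\<lambda>x. ennreal (g x) * indicator S x) = ennreal (N powr (1 / q))"
  proof -
    have "ennreal_powr (ennreal (g x) * indicator S x) q = ennreal (g x powr q) * indicator S x" for x
      using g0 ennreal_powr_ennreal[of 0 q] by (simp add: indicator_def)
    then show ?thesis
      using p N by (simp add: Lp_norm_def nn_integral_completion flip: q_def)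
  qed
  have "g \<in> nonneg_Lp (completion X) p"
    using norm_g g0 by (auto simp: nonneg_Lp_def measurable_completion intro: le_less_trans)
  then have "Lp_norm (completion X) p (hardy \<phi> g) \<le> ennreal C * Lp_norm (completion X) p (\<lambda>x. ennreal (g x))"
    by (rule C)
  also have "\<dots> \<le> ennreal C * ennreal (K powr (1 / q) * N powr (1 / q))"
    using norm_g by (intro mult_left_mono) auto
  finally have upper: "Lp_norm (completion X) p (hardy \<phi> g) \<le> ennreal C * ennreal (K powr (1 / q) * N powr (1 / q))" .
  have "?I * ennreal (N powr (1 / q)) = Lp_norm (completion X) p (\<lambda>x. ?I * (ennreal (g x) * indicator S x))"
    unfolding norm_gS[symmetric] using p p0
    by (intro Lp_norm_cmult[symmetric] measurable_completion) auto
  also have "\<dots> \<le> Lp_norm (completion X) p (hardy \<phi> g)"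
  proof (intro Lp_norm_mono AE_I2 p p0)
    fix x assume x: "x \<in> space (completion X)"
    show "?I * (ennreal (g x) * indicator S x) \<le> hardy \<phi> g x"
    proof (cases "x \<in> S")
      case True
      have w': "w \<in> borel_measurable (completion B)" "indicator E \<in> borel_measurable (completion B)"
        by (rule measurable_completion, measurable)+
      have "?I * ennreal (g x) = (\<integral>\<^sup>+ t. ennreal (w t * \<phi> t) * indicator E t * ennreal (g x) \<partial>completion B)"
        using w' by (intro nn_integral_multc[symmetric] borel_measurable_times_ennreal) auto
      also have "\<dots> \<le> hardy \<phi> g x"
        unfolding hardy_def
      proof (intro nn_integral_mono)
        fix t assume "t \<in> space (completion B)"
        then show "ennreal (w t * \<phi> t) * indicator E t * ennreal (g x) \<le> ennreal (g (D t x) * \<phi> t)"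
          using mult_right_mono[OF homogeneous[of t x], of "\<phi> t"] True \<phi>0[of t] g0 w0
          by (auto simp: indicator_def mult_ac intro!: ennreal_leI simp flip: ennreal_mult)
      qed
      finally show ?thesis using True by simp
    qed simp
  qed
  also note upper
  finally have "?I * ennreal (N powr (1 / q)) \<le> ennreal (C * K powr (1 / q)) * ennreal (N powr (1 / q))"
    using C K N by (simp add: mult.assoc flip: ennreal_mult)
  then have "ennreal (N powr (1 / q)) * ?I \<le> ennreal (N powr (1 / q)) * ennreal (C * K powr (1 / q))"
    by (simp only: mult.commute)
  \<comment> \<open>Cancelling is legitimate because the common factor is nonzero and finite:
    \<open>N\<close> is a positive real.\<close>
  then have "?I \<le> ennreal (C * K powr (1 / q))"
    using N by (subst (asm) ennreal_mult_le_mult_iff) auto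
  then show ?thesis unfolding q_def .
qed

end

section \<open>Dilations of product measures\<close>

text \<open>A product measure is determined by its values on boxes. The preimage of a box under a
  coordinatewise map is a box, so the scaling factors of the coordinates multiply.\<close>

lemma PiM_eq_scale_measure_distr:
  assumes "product_sigma_finite M" "finite I"
    and g [measurable]: "\<And>i. i \<in> I \<Longrightarrow> g i \<in> M i \<rightarrow>\<^sub>M M i"
    and eq: "\<And>i. i \<in> I \<Longrightarrow> M i = scale_measure (s i) (distr (M i) (M i) (g i))"
  shows "PiM I M = scale_measure (\<Prod>i\<in>I. s i) (distr (PiM I M) (PiM I M) (\<lambda>x. \<lambda>i\<in>I. g i (x i)))"
proof -
  interpret product_sigma_finite M by fact
  have G [measurable]: "(\<lambda>x. \<lambda>i\<in>I. g i (x i)) \<in> PiM I M \<rightarrow>\<^sub>M PiM I M"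
    by measurable
  show ?thesis
  proof (rule PiM_eqI[symmetric])
    fix A assume A: "\<And>i. i \<in> I \<Longrightarrow> A i \<in> sets (M i)"
    have vimage: "(\<lambda>x. \<lambda>i\<in>I. g i (x i)) -` Pi\<^sub>E I A \<inter> space (PiM I M) = (\<Pi>\<^sub>E i\<in>I. g i -` A i \<inter> space (M i))"
      by (auto simp: space_PiM PiE_iff)
    have "emeasure (scale_measure (\<Prod>i\<in>I. s i) (distr (PiM I M) (PiM I M) (\<lambda>x. \<lambda>i\<in>I. g i (x i)))) (Pi\<^sub>E I A)
        = (\<Prod>i\<in>I. s i) * (\<Prod>i\<in>I. emeasure (M i) (g i -` A i \<inter> space (M i)))"
      using A assms(2) G by (simp add: emeasure_distr sets_PiM_I_finite vimage emeasure_PiM measurable_sets[OF g])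
    also have "\<dots> = (\<Prod>i\<in>I. s i * emeasure (M i) (g i -` A i \<inter> space (M i)))"
      by (simp add: prod.distrib)
    also have "\<dots> = (\<Prod>i\<in>I. emeasure (M i) (A i))"
    proof (rule prod.cong)
      fix i assume i: "i \<in> I"
      have "emeasure (M i) (A i) = emeasure (scale_measure (s i) (distr (M i) (M i) (g i))) (A i)"
        using eq[OF i] by simp
      then show "s i * emeasure (M i) (g i -` A i \<inter> space (M i)) = emeasure (M i) (A i)"
        using A[OF i] g[OF i] by (simp add: emeasure_distr)
    qed simp
    finally show "emeasure (scale_measure (\<Prod>i\<in>I. s i) (distr (PiM I M) (PiM I M) (\<lambda>x. \<lambda>i\<in>I. g i (x i)))) (Pi\<^sub>E I A)
        = (\<Prod>i\<in>I. emeasure (M i) (A i))" .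
  qed (use assms in auto)
qed

lemma nn_integral_scale_measure_distr:
  assumes eq: "M = scale_measure s (distr M M g)"
    and [measurable]: "g \<in> M \<rightarrow>\<^sub>M M" "f \<in> borel_measurable M"
  shows "(\<integral>\<^sup>+ x. f x \<partial>M) = s * (\<integral>\<^sup>+ x. f (g x) \<partial>M)"
proof -
  have "(\<integral>\<^sup>+ x. f x \<partial>M) = (\<integral>\<^sup>+ x. f x \<partial>scale_measure s (distr M M g))"
    using eq by (rule arg_cong)
  then show ?thesis by (simp add: nn_integral_scale_measure nn_integral_distr)
qed

lemma lborel_eq_scale_measure_distr:
  fixes c :: real
  assumes "0 < c"
  shows "lborel = scale_measure (ennreal c) (distr lborel lborel ((*) c))"
proof (rule measure_eqI)
  fix A :: "real set" assume A: "A \<in> sets lborel"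
  have "emeasure lborel A = emeasure (density (distr lborel borel ((*) c)) (\<lambda>_. ennreal \<bar>c\<bar>)) A"
    using lborel_distr_mult'[of c] assms by simp
  also have "\<dots> = emeasure (scale_measure (ennreal c) (distr lborel lborel ((*) c))) A"
    using A assms by (simp add: emeasure_density nn_integral_cmult emeasure_distr)
  finally show "emeasure lborel A = emeasure (scale_measure (ennreal c) (distr lborel lborel ((*) c))) A" .
qed simp

section \<open>Product measures on Heisenberg groups and the cube, before completion\<close>

abbreviation heis_haar :: "nat \<Rightarrow> (nat \<Rightarrow> real) measure" where
  "heis_haar n \<equiv> PiM {1..2 * n + 1} (\<lambda>_. lborel)"

abbreviation heis_prod_haar :: "nat \<Rightarrow> (nat \<Rightarrow> nat) \<Rightarrow> (nat \<Rightarrow> nat \<Rightarrow> real) measure" where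
  "heis_prod_haar m n \<equiv> PiM {1..m} (\<lambda>i. heis_haar (n i))"

abbreviation cube_measure :: "nat \<Rightarrow> (nat \<Rightarrow> real) measure" where
  "cube_measure m \<equiv> PiM {1..m} (\<lambda>_. restrict_space lborel {0..1})"

abbreviation dilation_jacobian :: "nat \<Rightarrow> (nat \<Rightarrow> nat) \<Rightarrow> (nat \<Rightarrow> real) \<Rightarrow> real" where
  "dilation_jacobian m n t \<equiv> \<Prod>i=1..m. t i ^ heis_hdim (n i)"

lemma product_sigma_finite_lborel: "product_sigma_finite (\<lambda>_. lborel)" ..

lemma product_sigma_finite_heis_haar: "product_sigma_finite (\<lambda>i. heis_haar (n i))"
  by (intro product_sigma_finite.intro product_sigma_finite.sigma_finite
      product_sigma_finite_lborel) simp

lemma prob_space_unit_interval: "prob_space (restrict_space lborel {0..1::real})"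
  by (rule prob_spaceI) (simp add: space_restrict_space emeasure_restrict_space)

lemma prob_space_cube_measure: "prob_space (cube_measure m)"
  by (intro prob_space_PiM prob_space_unit_interval)

lemma measurable_heis_dilation [measurable (raw)]:
  assumes [measurable]: "r \<in> borel_measurable M" "x \<in> M \<rightarrow>\<^sub>M heis_haar n"
  shows "(\<lambda>z. heis_dilation n (r z) (x z)) \<in> M \<rightarrow>\<^sub>M heis_haar n"
proof -
  have [measurable]: "(\<lambda>z. x z j) \<in> borel_measurable M" if "j \<in> {1..2 * n + 1}" for j
    using measurable_compose[OF assms(2) measurable_component_singleton[OF that]] by simp
  show ?thesis
    unfolding heis_dilation_def by (intro measurable_restrict) auto
qed

lemma measurable_cube_component:
  "i \<in> {1..m} \<Longrightarrow> (\<lambda>t. t i) \<in> borel_measurable (cube_measure m)"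
  using measurable_compose[OF measurable_component_singleton, of i "{1..m}" "\<lambda>x. x" "\<lambda>_. restrict_space lborel {0..1::real}" borel]
  by (simp add: measurable_restrict_space1)

lemma measurable_prod_dilation:
  "(\<lambda>(t, x). prod_dilation m n t x) \<in> cube_measure m \<Otimes>\<^sub>M heis_prod_haar m n \<rightarrow>\<^sub>M heis_prod_haar m n"
  unfolding prod_dilation_def case_prod_beta
proof (intro measurable_restrict)
  fix i assume i: "i \<in> {1..m}"
  have "(\<lambda>z. fst z i) \<in> borel_measurable (cube_measure m \<Otimes>\<^sub>M heis_prod_haar m n)"
    by (rule measurable_compose[OF measurable_fst measurable_cube_component[OF i]])
  moreover have "(\<lambda>z. snd z i) \<in> cube_measure m \<Otimes>\<^sub>M heis_prod_haar m n \<rightarrow>\<^sub>M heis_haar (n i)"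
    by (rule measurable_compose[OF measurable_snd measurable_component_singleton[OF i]])
  ultimately show "(\<lambda>z. heis_dilation (n i) (fst z i) (snd z i))
      \<in> cube_measure m \<Otimes>\<^sub>M heis_prod_haar m n \<rightarrow>\<^sub>M heis_haar (n i)"
    by (rule measurable_heis_dilation)
qed

text \<open>The first \<open>2 * n\<close> coordinates scale by \<open>r\<close> and the last one by
  its square, which adds up to the homogeneous dimension \<open>2 * n + 2\<close>.\<close>

lemma heis_haar_eq_scale_measure_distr:
  assumes "0 < r"
  shows "heis_haar n = scale_measure (ennreal (r ^ heis_hdim n))
    (distr (heis_haar n) (heis_haar n) (heis_dilation n r))"
proof -
  have "heis_haar n = scale_measure (\<Prod>j=1..2 * n + 1. ennreal (if j = 2 * n + 1 then r\<^sup>2 else r))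
      (distr (heis_haar n) (heis_haar n)
        (\<lambda>x. \<lambda>j\<in>{1..2 * n + 1}. (if j = 2 * n + 1 then r\<^sup>2 else r) * x j))"
    using assms
    by (intro PiM_eq_scale_measure_distr product_sigma_finite_lborel lborel_eq_scale_measure_distr) auto
  moreover have "(\<lambda>x. \<lambda>j\<in>{1..2 * n + 1}. (if j = 2 * n + 1 then r\<^sup>2 else r) * x j) = heis_dilation n r"
    by (auto simp: heis_dilation_def fun_eq_iff)
  moreover have "(\<Prod>j=1..2 * n + 1. ennreal (if j = 2 * n + 1 then r\<^sup>2 else r)) = ennreal (r ^ heis_hdim n)"
  proof -
    have "(\<Prod>j=1..2 * n. if j = 2 * n + 1 then r\<^sup>2 else r) = (\<Prod>j=1..2 * n. r)"
      by (intro prod.cong) auto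
    then have "(\<Prod>j=1..2 * n + 1. if j = 2 * n + 1 then r\<^sup>2 else r) = r ^ heis_hdim n"
      by (simp add: heis_hdim_def power2_eq_square)
    moreover have "(\<Prod>j=1..2 * n + 1. ennreal (if j = 2 * n + 1 then r\<^sup>2 else r))
        = ennreal (\<Prod>j=1..2 * n + 1. if j = 2 * n + 1 then r\<^sup>2 else r)"
      using assms by (intro prod_ennreal) auto
    ultimately show ?thesis by simp
  qed
  ultimately show ?thesis by metis
qed

lemma nn_integral_heis_dilation:
  assumes "0 < r" and [measurable]: "g \<in> borel_measurable (heis_haar n)"
  shows "(\<integral>\<^sup>+ x. g x \<partial>heis_haar n)
    = ennreal (r ^ heis_hdim n) * (\<integral>\<^sup>+ x. g (heis_dilation n r x) \<partial>heis_haar n)"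
  by (intro nn_integral_scale_measure_distr heis_haar_eq_scale_measure_distr assms) measurable

text \<open>A second use of \<open>PiM_eq_scale_measure_distr\<close>, now with whole Heisenberg
  groups as the coordinates.\<close>

lemma nn_integral_prod_dilation:
  assumes t: "\<And>i. i \<in> {1..m} \<Longrightarrow> 0 < t i"
    and [measurable]: "g \<in> borel_measurable (heis_prod_haar m n)"
  shows "(\<integral>\<^sup>+ x. g x \<partial>heis_prod_haar m n)
    = ennreal (dilation_jacobian m n t) * (\<integral>\<^sup>+ x. g (prod_dilation m n t x) \<partial>heis_prod_haar m n)"
proof -
  have D [measurable]: "prod_dilation m n t \<in> heis_prod_haar m n \<rightarrow>\<^sub>M heis_prod_haar m n"
    unfolding prod_dilation_def by measurable
  have "heis_prod_haar m n = scale_measure (\<Prod>i=1..m. ennreal (t i ^ heis_hdim (n i)))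
      (distr (heis_prod_haar m n) (heis_prod_haar m n) (prod_dilation m n t))"
    unfolding prod_dilation_def using t
    by (intro PiM_eq_scale_measure_distr product_sigma_finite_heis_haar heis_haar_eq_scale_measure_distr)
      measurable
  moreover have "(\<Prod>i=1..m. ennreal (t i ^ heis_hdim (n i))) = ennreal (dilation_jacobian m n t)"
    using t by (intro prod_ennreal) (simp add: less_imp_le)
  ultimately show ?thesis
    by (intro nn_integral_scale_measure_distr D assms(2)) metis
qed

text \<open>Isolates the null set on which some dilation degenerates, the Jacobian vanishes and the
  convention for \<open>0 powr s\<close> intervenes.\<close>

lemma AE_cube_pos: "AE t in cube_measure m. \<forall>i\<in>{1..m}. 0 < t i"
proof (intro AE_finite_allI AE_PiM_component[where M = "\<lambda>_. restrict_space lborel {0..1::real}"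
        and P = "\<lambda>s. 0 < s"] prob_space_unit_interval)
  have "AE s in lborel. s \<noteq> (0::real)" by (rule AE_lborel_singleton)
  then show "AE s in restrict_space lborel {0..1::real}. 0 < s"
    by (auto simp: AE_restrict_space_iff elim!: eventually_mono)
qed auto

lemma dilation_family_heis:
  "dilation_family (heis_prod_haar m n) (cube_measure m) (prod_dilation m n) (dilation_jacobian m n)"
proof (intro dilation_family.intro dilation_family_axioms.intro)
  show "sigma_finite_measure (heis_prod_haar m n)"
    by (intro product_sigma_finite.sigma_finite product_sigma_finite_heis_haar) simp
  show "sigma_finite_measure (cube_measure m)"
    using prob_space_cube_measure
    by (simp add: prob_space_def finite_measure.axioms(1))
  show "dilation_jacobian m n \<in> borel_measurable (cube_measure m)"
    by (intro borel_measurable_prod borel_measurable_power measurable_cube_component) 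
  show "AE t in cube_measure m. 0 < dilation_jacobian m n t"
    using AE_cube_pos by eventually_elim (auto intro!: prod_pos)
  show "AE t in cube_measure m. \<forall>g\<in>borel_measurable (heis_prod_haar m n).
      (\<integral>\<^sup>+ x. g x \<partial>heis_prod_haar m n)
        = ennreal (dilation_jacobian m n t) * (\<integral>\<^sup>+ x. g (prod_dilation m n t x) \<partial>heis_prod_haar m n)"
    using AE_cube_pos by eventually_elim (intro ballI nn_integral_prod_dilation, blast+)
qed (rule measurable_prod_dilation)

section \<open>Homogeneous test functions\<close>

text \<open>A gauge homogeneous of degree 1 under the dilations, thanks to the square root on the
  last coordinate. The maximum is chosen because its balls are boxes, whose measure is a
  product.\<close>

definition heis_norm :: "nat \<Rightarrow> (nat \<Rightarrow> real) \<Rightarrow> real" where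
  "heis_norm n x = Max ((\<lambda>j. if j = 2 * n + 1 then sqrt \<bar>x j\<bar> else \<bar>x j\<bar>) ` {1..2 * n + 1})"

lemma heis_norm_nonneg: "0 \<le> heis_norm n x"
proof -
  have "0 \<le> sqrt \<bar>x (2 * n + 1)\<bar>" by simp
  also have "\<dots> \<le> heis_norm n x"
    unfolding heis_norm_def by (intro Max_ge) (auto simp: image_iff intro!: bexI[of _ "2 * n + 1"])
  finally show ?thesis .
qed

lemma heis_norm_less_iff:
  assumes "0 < b"
  shows "heis_norm n x < b \<longleftrightarrow>
    (\<forall>j\<in>{1..2 * n + 1}. \<bar>x j\<bar> < (if j = 2 * n + 1 then b\<^sup>2 else b))"
proof -
  have "sqrt \<bar>y\<bar> < b \<longleftrightarrow> \<bar>y\<bar> < b\<^sup>2" for y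
    using assms by (metis abs_ge_zero abs_of_pos real_sqrt_abs real_sqrt_less_iff)
  then show ?thesis
    unfolding heis_norm_def by (subst Max_less_iff) auto
qed

lemma heis_norm_dilation:
  assumes "0 \<le> r"
  shows "heis_norm n (heis_dilation n r x) = r * heis_norm n x"
proof -
  have "r * heis_norm n x
      = Max ((*) r ` (\<lambda>j. if j = 2 * n + 1 then sqrt \<bar>x j\<bar> else \<bar>x j\<bar>) ` {1..2 * n + 1})"
    unfolding heis_norm_def
    using assms by (intro mono_Max_commute) (auto intro!: monoI mult_left_mono)
  also have "(*) r ` (\<lambda>j. if j = 2 * n + 1 then sqrt \<bar>x j\<bar> else \<bar>x j\<bar>) ` {1..2 * n + 1}
      = (\<lambda>j. if j = 2 * n + 1 then sqrt \<bar>heis_dilation n r x j\<bar> else \<bar>heis_dilation n r x j\<bar>) ` {1..2 * n + 1}"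
    unfolding image_image using assms
    by (intro image_cong) (auto simp: heis_dilation_def abs_mult real_sqrt_mult)
  finally show ?thesis by (simp add: heis_norm_def)
qed

lemma measurable_heis_norm [measurable]: "heis_norm n \<in> borel_measurable (heis_haar n)"
proof -
  have [measurable]: "(\<lambda>x. x j) \<in> borel_measurable (heis_haar n)" if "j \<in> {1..2 * n + 1}" for j
    using measurable_component_singleton[OF that, of "\<lambda>_. lborel"] by simp
  have "(\<lambda>x. if j = 2 * n + 1 then sqrt \<bar>x j\<bar> else \<bar>x j\<bar>) \<in> borel_measurable (heis_haar n)"
    if [measurable]: "j \<in> {1..2 * n + 1}" for j
    by measurable
  then show ?thesis
    unfolding heis_norm_def by (intro borel_measurable_Max) simp_all
qed

text \<open>The exponent of the weight below is critical: its integral over a shell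
  \<open>a \<le> heis_norm n x < b\<close> depends only on \<open>b / a\<close>.\<close>

definition shell_weight :: "nat \<Rightarrow> real \<Rightarrow> real \<Rightarrow> (nat \<Rightarrow> real) \<Rightarrow> real" where
  "shell_weight n a b x =
     (if a \<le> heis_norm n x \<and> heis_norm n x < b then heis_norm n x powr (- real (heis_hdim n)) else 0)"

lemma measurable_shell_weight [measurable]: "shell_weight n a b \<in> borel_measurable (heis_haar n)"
  unfolding shell_weight_def by measurable

lemma shell_weight_nonneg: "0 \<le> shell_weight n a b x"
  by (simp add: shell_weight_def)

text \<open>On the shell the gauge is at least 1, so the weight is at most 1, and the shell lies in
  a bounded box.\<close>

lemma shell_weight_integral_finite:
  assumes "0 < b"
  shows "(\<integral>\<^sup>+ x. ennreal (shell_weight n 1 b x) \<partial>heis_haar n) < \<infinity>"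
proof -
  define A where "A j = (if j = 2 * n + 1 then {- b\<^sup>2..b\<^sup>2} else {- b..b})" for j
  have A_meas: "A j \<in> sets lborel" for j by (simp add: A_def)
  have "(\<integral>\<^sup>+ x. ennreal (shell_weight n 1 b x) \<partial>heis_haar n)
      \<le> (\<integral>\<^sup>+ x. indicator (Pi\<^sub>E {1..2 * n + 1} A) x \<partial>heis_haar n)"
  proof (intro nn_integral_mono)
    fix x assume x: "x \<in> space (heis_haar n)"
    show "ennreal (shell_weight n 1 b x) \<le> indicator (Pi\<^sub>E {1..2 * n + 1} A) x"
    proof (cases "1 \<le> heis_norm n x \<and> heis_norm n x < b")
      case True
      have "x j \<in> A j" if "j \<in> {1..2 * n + 1}" for j
      proof -
        have "\<bar>x j\<bar> < (if j = 2 * n + 1 then b\<^sup>2 else b)"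
          using True that heis_norm_less_iff[OF assms, of n x] by blast
        then show ?thesis by (auto simp: A_def split: if_splits)
      qed
      then have "x \<in> Pi\<^sub>E {1..2 * n + 1} A"
        using x unfolding space_PiM PiE_iff by blast
      moreover have "heis_norm n x powr (- real (heis_hdim n)) \<le> 1"
        using True powr_mono[of "- real (heis_hdim n)" 0 "heis_norm n x"] by simp
      ultimately show ?thesis using True by (simp add: shell_weight_def)
    next
      case False
      then show ?thesis by (simp only: shell_weight_def if_False ennreal_0 zero_le)
    qed
  qed
  also have "\<dots> = emeasure (heis_haar n) (Pi\<^sub>E {1..2 * n + 1} A)"
    by (intro nn_integral_indicator sets_PiM_I_finite A_meas) simp
  also have "\<dots> = (\<Prod>j=1..2 * n + 1. emeasure lborel (A j))"
    by (intro product_sigma_finite.emeasure_PiM product_sigma_finite_lborel A_meas) simp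
  also have "\<dots> < \<infinity>"
  proof -
    have "emeasure lborel (A j) \<noteq> top" for j
      using assms by (simp add: A_def)
    then show ?thesis
      by (simp only: less_top[symmetric] infinity_ennreal_def ennreal_prod_eq_top) blast
  qed
  finally show ?thesis .
qed

lemma shell_weight_integral_pos:
  assumes "1 < b"
  shows "0 < (\<integral>\<^sup>+ x. ennreal (shell_weight n 1 b x) \<partial>heis_haar n)"
proof (rule ccontr)
  \<comment> \<open>An open box of positive measure inside the shell: its upper ends keep the gauge
    below \<open>b\<close>, and the last coordinate alone, being above 1, keeps the gauge from being
    below 1.\<close>
  let ?A = "\<lambda>j. if j = 2 * n + 1 then {1<..<b\<^sup>2} else {1<..<b}"
  let ?P = "\<Pi>\<^sub>E j\<in>{1..2 * n + 1}. ?A j"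
  have b: "1 < b\<^sup>2" using assms by simp
  have P: "?P \<in> sets (heis_haar n)" by (intro sets_PiM_I_finite) auto
  assume "\<not> ?thesis"
  then have "(\<integral>\<^sup>+ x. ennreal (shell_weight n 1 b x) \<partial>heis_haar n) = 0"
    by (simp only: not_gr_zero)
  moreover have "(\<lambda>x. ennreal (shell_weight n 1 b x)) \<in> borel_measurable (heis_haar n)"
    by measurable
  ultimately have "AE x in heis_haar n. ennreal (shell_weight n 1 b x) = 0"
    by (simp only: nn_integral_0_iff_AE)
  then have "AE x in heis_haar n. x \<notin> ?P"
  proof eventually_elim
    case (elim x)
    show ?case
    proof
      assume x: "x \<in> ?P"
      have "heis_norm n x < b"
        using x assms by (subst heis_norm_less_iff) (fastforce simp: PiE_iff split: if_splits)+
      moreover have "1 < x (2 * n + 1)"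
        using PiE_mem[OF x, of "2 * n + 1"] by simp
      then have "\<not> heis_norm n x < 1"
        by (subst heis_norm_less_iff) (auto intro!: bexI[of _ "2 * n + 1"])
      ultimately show False using elim by (auto simp: shell_weight_def)
    qed
  qed
  then have "emeasure (heis_haar n) ?P = 0"
    using P by (simp only: AE_iff_null_sets[symmetric] null_setsD1)
  moreover have "emeasure (heis_haar n) ?P = (\<Prod>j=1..2 * n + 1. emeasure lborel (?A j))"
    by (intro product_sigma_finite.emeasure_PiM product_sigma_finite_lborel) auto
  ultimately show False
    using assms b by (auto simp: prod_zero_iff)
qed

text \<open>The shell splits at radius 1. Dilation by \<open>b\<close> carries the inner half onto
  the outer half, and the critical exponent cancels the Jacobian, so both halves have the same
  integral.\<close>

lemma shell_weight_integral_double: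
  assumes b: "1 < b"
  shows "(\<integral>\<^sup>+ x. ennreal (shell_weight n (1 / b) b x) \<partial>heis_haar n)
    = 2 * (\<integral>\<^sup>+ x. ennreal (shell_weight n 1 b x) \<partial>heis_haar n)"
proof -
  let ?c = "b ^ heis_hdim n"
  have split: "ennreal (shell_weight n (1 / b) b x)
      = ennreal (shell_weight n 1 b x) + ennreal ?c * ennreal (shell_weight n 1 b (heis_dilation n b x))" for x
  proof -
    have "1 / b < 1" using b by simp
    \<comment> \<open>The cancellation of Jacobian and weight; at gauge 0 both sides are 0.\<close>
    moreover have "?c * (b * heis_norm n x) powr (- real (heis_hdim n)) = heis_norm n x powr (- real (heis_hdim n))"
      using b heis_norm_nonneg[of n x]
      by (simp add: powr_mult powr_minus powr_realpow)
    moreover have "1 \<le> b * heis_norm n x \<longleftrightarrow> 1 / b \<le> heis_norm n x"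
      using b by (simp add: field_simps)
    moreover have "1 \<le> b * heis_norm n x" if "1 \<le> heis_norm n x"
      using b that mult_mono[of 1 b 1 "heis_norm n x"] by simp
    moreover have "b * heis_norm n x < b \<longleftrightarrow> heis_norm n x < 1"
      using b by simp
    ultimately have "shell_weight n (1 / b) b x
        = shell_weight n 1 b x + ?c * shell_weight n 1 b (heis_dilation n b x)"
      using b by (auto simp: shell_weight_def heis_norm_dilation)
    then show ?thesis
      using b by (simp add: shell_weight_nonneg flip: ennreal_mult ennreal_plus)
  qed
  have meas: "(\<lambda>x. ennreal (shell_weight n 1 b x)) \<in> borel_measurable (heis_haar n)"
    "(\<lambda>x. ennreal (shell_weight n 1 b (heis_dilation n b x))) \<in> borel_measurable (heis_haar n)"
    by measurable
  have "(\<integral>\<^sup>+ x. ennreal (shell_weight n (1 / b) b x) \<partial>heis_haar n)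
      = (\<integral>\<^sup>+ x. ennreal (shell_weight n 1 b x) \<partial>heis_haar n)
        + ennreal ?c * (\<integral>\<^sup>+ x. ennreal (shell_weight n 1 b (heis_dilation n b x)) \<partial>heis_haar n)"
    unfolding split using meas by (simp only: nn_integral_add nn_integral_cmult borel_measurable_times_ennreal borel_measurable_const)
  also have "ennreal ?c * (\<integral>\<^sup>+ x. ennreal (shell_weight n 1 b (heis_dilation n b x)) \<partial>heis_haar n)
      = (\<integral>\<^sup>+ x. ennreal (shell_weight n 1 b x) \<partial>heis_haar n)"
    using b meas(1) by (intro nn_integral_heis_dilation[symmetric]) auto
  finally show ?thesis by (simp only: mult_2)
qed

lemma weighted_hardy_eq:
  "weighted_hardy m n \<phi> = dilation_family.hardy (cube_measure m) (prod_dilation m n) \<phi>"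
  by (intro ext) (simp only: weighted_hardy_def cube_lebesgue_def
      dilation_family.hardy_def[OF dilation_family_heis])

text \<open>Identifies the abstract weight, a power of the Jacobian, with the concrete product.
  Positivity of each \<open>t i\<close> is what turns natural powers into real ones.\<close>

lemma dilation_jacobian_powr:
  assumes "\<And>i. i \<in> {1..m} \<Longrightarrow> 0 < t i"
  shows "dilation_jacobian m n t powr (- (if p = \<infinity> then 0 else 1 / enn2real p))
    = (\<Prod>i=1..m. t i powr (- hdim_quotient (n i) p))"
proof -
  let ?e = "- (if p = \<infinity> then 0 else 1 / enn2real p)"
  have "dilation_jacobian m n t powr ?e = (\<Prod>i=1..m. (t i ^ heis_hdim (n i)) powr ?e)"
    by (rule prod_powr_distrib)
  also have "\<dots> = (\<Prod>i=1..m. t i powr (- hdim_quotient (n i) p))"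
  proof (rule prod.cong)
    fix i assume i: "i \<in> {1..m}"
    have "(t i ^ heis_hdim (n i)) powr ?e = t i powr (real (heis_hdim (n i)) * ?e)"
      using assms[OF i] by (simp only: powr_realpow[symmetric] powr_powr)
    then show "(t i ^ heis_hdim (n i)) powr ?e = t i powr (- hdim_quotient (n i) p)"
      by (simp add: hdim_quotient_def)
  qed simp
  finally show ?thesis .
qed

section \<open>Necessity on the Heisenberg groups, for infinite and for finite exponent\<close>

text \<open>Ensures that the essential supremum of a constant is that constant.\<close>

lemma emeasure_heis_prod_haar_space_nonzero:
  "emeasure (heis_prod_haar m n) (space (heis_prod_haar m n)) \<noteq> 0"
proof -
  have "emeasure (heis_haar k) (space (heis_haar k)) \<noteq> 0" for k
  proof -
    have "emeasure (heis_haar k) (space (heis_haar k)) = (\<Prod>j=1..2 * k + 1. emeasure lborel (UNIV :: real set))"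
      unfolding space_PiM space_lborel space_borel
      by (intro product_sigma_finite.emeasure_PiM product_sigma_finite_lborel) auto
    then show ?thesis by (simp add: prod_zero_iff)
  qed
  moreover have "emeasure (heis_prod_haar m n) (space (heis_prod_haar m n))
      = (\<Prod>i=1..m. emeasure (heis_haar (n i)) (space (heis_haar (n i))))"
    unfolding space_PiM[of "{1..m}"]
    by (intro product_sigma_finite.emeasure_PiM product_sigma_finite_heis_haar) auto
  ultimately show ?thesis by simp
qed

text \<open>The function 1 is invariant under dilations, so its image is the constant whose value is
  the integral of \<open>\<phi>\<close>.\<close>

lemma weight_integral_le_if_Lp_bounded_infinity:
  assumes C: "\<And>f. f \<in> nonneg_Lp (heis_prod_lebesgue m n) \<infinity> \<Longrightarrow>
      Lp_norm (heis_prod_lebesgue m n) \<infinity> (weighted_hardy m n \<phi> f)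
        \<le> ennreal C * Lp_norm (heis_prod_lebesgue m n) \<infinity> (\<lambda>x. ennreal (f x))"
  shows "(\<integral>\<^sup>+ t. ennreal (\<phi> t) \<partial>cube_lebesgue m) \<le> ennreal C"
proof -
  let ?M = "heis_prod_lebesgue m n"
  have ne: "emeasure ?M (space ?M) \<noteq> 0"
    using emeasure_heis_prod_haar_space_nonzero[of m n] by (simp add: heis_prod_lebesgue_def)
  have one: "Lp_norm ?M \<infinity> (\<lambda>_. ennreal 1) = ennreal 1"
    using esssup_const[OF ne] by (simp add: Lp_norm_def)
  have "weighted_hardy m n \<phi> (\<lambda>_. 1) = (\<lambda>_. \<integral>\<^sup>+ t. ennreal (\<phi> t) \<partial>cube_lebesgue m)"
    by (simp add: weighted_hardy_def fun_eq_iff)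
  then have "Lp_norm ?M \<infinity> (weighted_hardy m n \<phi> (\<lambda>_. 1)) = (\<integral>\<^sup>+ t. ennreal (\<phi> t) \<partial>cube_lebesgue m)"
    using esssup_const[OF ne] by (simp add: Lp_norm_def)
  moreover have "(\<lambda>_. 1) \<in> nonneg_Lp ?M \<infinity>"
    using one by (simp add: nonneg_Lp_def)
  ultimately show ?thesis
    using C[of "\<lambda>_. 1"] one by simp
qed

text \<open>On the dilated point \<open>prod_dilation m n t x\<close> with \<open>1 / b \<le> t i \<le> 1\<close> and every
  \<open>x i\<close> in the shell \<open>[1, b)\<close>, the test function built on the shells \<open>[1 / b, b)\<close> takes
  exactly its value at \<open>x\<close> times the weight.  Since \<open>[1 / b, b)\<close> splits into two shells of
  ratio \<open>b\<close>, passing to the smaller shells costs a factor \<open>2 ^ m\<close>, independent of \<open>b\<close>.\<close>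

lemma truncated_weight_integral_le:
  assumes p: "1 \<le> p" "p \<noteq> \<infinity>"
    and \<phi>: "\<phi> \<in> borel_measurable (cube_lebesgue m)"
    and \<phi>0: "\<And>t. t \<in> space (cube_lebesgue m) \<Longrightarrow> 0 \<le> \<phi> t"
    and C: "0 \<le> C" "\<And>f. f \<in> nonneg_Lp (heis_prod_lebesgue m n) p \<Longrightarrow>
      Lp_norm (heis_prod_lebesgue m n) p (weighted_hardy m n \<phi> f)
        \<le> ennreal C * Lp_norm (heis_prod_lebesgue m n) p (\<lambda>x. ennreal (f x))"
    and b: "1 < b"
  shows "(\<integral>\<^sup>+ t. ennreal ((\<Prod>i=1..m. t i powr (- hdim_quotient (n i) p)) * \<phi> t)
      * indicator {t \<in> space (cube_measure m). \<forall>i\<in>{1..m}. 1 / b \<le> t i} t \<partial>cube_lebesgue m)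
    \<le> ennreal (C * (2 ^ m) powr (1 / enn2real p))"
proof -
  interpret dilation_family "heis_prod_haar m n" "cube_measure m" "prod_dilation m n" "dilation_jacobian m n"
    by (rule dilation_family_heis)
  define q where "q = enn2real p"
  have q: "1 \<le> q" using p by (cases p) (simp_all add: q_def)
  have hq: "hdim_quotient k p = real (heis_hdim k) / q" for k
    using p by (simp add: hdim_quotient_def q_def)
  have component: "(\<lambda>x. x i) \<in> heis_prod_haar m n \<rightarrow>\<^sub>M heis_haar (n i)" if "i \<in> {1..m}" for i
    by (rule measurable_component_singleton[OF that])
  have norm_component: "(\<lambda>x. heis_norm (n i) (x i)) \<in> borel_measurable (heis_prod_haar m n)"
    if "i \<in> {1..m}" for i
    by (rule measurable_compose[OF component[OF that] measurable_heis_norm])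
  \<comment> \<open>The root makes \<open>g x powr q\<close> a product of shell weights, so its
    integral factors, and gives \<open>g\<close> the degree \<open>- hdim_quotient (n i) p\<close>
    in the i-th variable inside the shells.\<close>
  define g where "g x = (\<Prod>i=1..m. shell_weight (n i) (1 / b) b (x i) powr (1 / q))" for x
  define S where "S = {x \<in> space (heis_prod_haar m n).
    \<forall>i\<in>{1..m}. 1 \<le> heis_norm (n i) (x i) \<and> heis_norm (n i) (x i) < b}"
  define E where "E = {t \<in> space (cube_measure m). \<forall>i\<in>{1..m}. 1 / b \<le> t i}"
  define w where "w t = (\<Prod>i=1..m. t i powr (- hdim_quotient (n i) p))" for t :: "nat \<Rightarrow> real"
  have g_meas: "g \<in> borel_measurable (heis_prod_haar m n)"
    unfolding g_def
    by (intro borel_measurable_prod powr_real_measurable measurable_compose[OF component measurable_shell_weight])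
      simp_all
  have S_meas: "S \<in> sets (heis_prod_haar m n)"
    unfolding S_def
    by (intro sets.sets_Collect_finite_All sets.sets_Collect_conj borel_measurable_le borel_measurable_less
        norm_component borel_measurable_const) auto
  have E_meas: "E \<in> sets (cube_measure m)"
    unfolding E_def
    by (intro sets.sets_Collect_finite_All borel_measurable_le measurable_cube_component
        borel_measurable_const) auto
  have w_meas: "w \<in> borel_measurable (cube_measure m)"
    unfolding w_def
    by (intro borel_measurable_prod powr_real_measurable measurable_cube_component borel_measurable_const)
  have g0: "0 \<le> g x" for x by (simp add: g_def prod_nonneg)
  have w0: "0 \<le> w t" for t by (simp add: w_def prod_nonneg)
  have gq: "g x powr q = (\<Prod>i=1..m. shell_weight (n i) (1 / b) b (x i))" for x
    using q by (simp add: g_def prod_powr_distrib powr_powr shell_weight_nonneg)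
  have gS: "ennreal (g x powr q) * indicator S x = (\<Prod>i=1..m. ennreal (shell_weight (n i) 1 b (x i)))"
    if x: "x \<in> space (heis_prod_haar m n)" for x
  proof (cases "x \<in> S")
    case True
    have "shell_weight (n i) (1 / b) b (x i) = shell_weight (n i) 1 b (x i)" if "i \<in> {1..m}" for i
    proof -
      have "1 / b \<le> 1" using b by simp
      moreover have "1 \<le> heis_norm (n i) (x i)" "heis_norm (n i) (x i) < b"
        using True that by (auto simp: S_def)
      moreover from calculation have "1 / b \<le> heis_norm (n i) (x i)" by linarith
      ultimately show ?thesis by (simp add: shell_weight_def)
    qed
    then show ?thesis
      using True by (simp add: gq prod_ennreal shell_weight_nonneg)
  next
    case False
    then obtain i where i: "i \<in> {1..m}" "\<not> (1 \<le> heis_norm (n i) (x i) \<and> heis_norm (n i) (x i) < b)"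
      using x unfolding S_def by blast
    then have "shell_weight (n i) 1 b (x i) = 0"
      unfolding shell_weight_def by (simp only: if_False)
    then have "(\<Prod>i=1..m. ennreal (shell_weight (n i) 1 b (x i))) = 0"
      using i(1) by (intro prod_zero bexI[of _ i]) simp_all
    then show ?thesis using False by simp
  qed
  have homogeneous: "w t * g x \<le> g (prod_dilation m n t x)" if t: "t \<in> E" and x: "x \<in> S" for t x
  proof -
    have "t i powr (- hdim_quotient (n i) p) * shell_weight (n i) (1 / b) b (x i) powr (1 / q)
        = shell_weight (n i) (1 / b) b (prod_dilation m n t x i) powr (1 / q)" if i: "i \<in> {1..m}" for i
    proof -
      let ?r = "heis_norm (n i) (x i)"
      have r: "1 \<le> ?r" "?r < b" using x i by (auto simp: S_def)
      have ti: "1 / b \<le> t i" using t i by (auto simp: E_def)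
      have "t i \<in> {0..1}"
        using t i by (auto simp: E_def space_PiM space_restrict_space dest: PiE_mem)
      then have t1: "t i \<le> 1" by simp
      have tpos: "0 < t i" using ti b by (smt (verit) divide_pos_pos)
      have "1 / b \<le> 1" using b by simp
      with r have bound: "1 / b \<le> ?r" by linarith
      \<comment> \<open>The dilated radius stays below \<open>b\<close> because
        \<open>t i \<le> 1\<close>, and stays at least \<open>1 / b\<close> because
        \<open>1 / b \<le> t i\<close> and \<open>1 \<le> ?r\<close>. This is why \<open>S\<close>
        uses only the outer shells.\<close>
      have "t i * ?r \<le> ?r" using mult_right_mono[of "t i" 1 ?r] r t1 by simp
      with r have "t i * ?r < b" by linarith
      moreover have "1 / b \<le> t i * ?r"
        using r ti t1 tpos b mult_mono[of "1 / b" "t i" 1 ?r] by auto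
      ultimately have bounds: "1 / b \<le> t i * ?r" "t i * ?r < b" by auto
      have "heis_norm (n i) (prod_dilation m n t x i) = t i * ?r"
        using i tpos by (simp add: prod_dilation_def heis_norm_dilation)
      then show ?thesis
        using bound bounds r tpos by (simp add: shell_weight_def powr_mult powr_powr hq)
    qed
    then show ?thesis
      unfolding w_def g_def prod.distrib[symmetric] by (intro eq_refl prod.cong) auto
  qed
  \<comment> \<open>The q-th power of the norm of \<open>g\<close> over \<open>S\<close>. It is a
    positive real because every shell integral is positive and finite.\<close>
  define N where "N = (\<Prod>i=1..m. enn2real (\<integral>\<^sup>+ x. ennreal (shell_weight (n i) 1 b x) \<partial>heis_haar (n i)))"
  have shell_eq: "ennreal (enn2real (\<integral>\<^sup>+ x. ennreal (shell_weight k 1 b x) \<partial>heis_haar k))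
      = (\<integral>\<^sup>+ x. ennreal (shell_weight k 1 b x) \<partial>heis_haar k)" for k
    by (rule ennreal_enn2real) (use shell_weight_integral_finite[of b k] b in simp)
  have N_eq: "ennreal N = (\<Prod>i=1..m. \<integral>\<^sup>+ x. ennreal (shell_weight (n i) 1 b x) \<partial>heis_haar (n i))"
    unfolding N_def by (subst prod_ennreal[symmetric]) (simp_all only: shell_eq enn2real_nonneg)
  have N_pos: "0 < N"
    unfolding N_def
  proof (intro prod_pos)
    fix i
    show "0 < enn2real (\<integral>\<^sup>+ x. ennreal (shell_weight (n i) 1 b x) \<partial>heis_haar (n i))"
      using shell_weight_integral_pos[OF b, of "n i"] shell_weight_integral_finite[of b "n i"] b
      by (simp add: enn2real_positive_iff)
  qed
  have meas: "(\<lambda>x. ennreal (shell_weight k c b x)) \<in> borel_measurable (heis_haar k)" for k c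
    by measurable
  have "(\<integral>\<^sup>+ x. ennreal (g x powr q) * indicator S x \<partial>heis_prod_haar m n)
      = (\<integral>\<^sup>+ x. (\<Prod>i=1..m. ennreal (shell_weight (n i) 1 b (x i))) \<partial>heis_prod_haar m n)"
    by (intro nn_integral_cong gS)
  also have "\<dots> = ennreal N"
    unfolding N_eq
    by (intro product_sigma_finite.product_nn_integral_prod product_sigma_finite_heis_haar meas) simp
  finally have int_S: "(\<integral>\<^sup>+ x. ennreal (g x powr q) * indicator S x \<partial>heis_prod_haar m n) = ennreal N" .
  have "(\<integral>\<^sup>+ x. ennreal (g x powr q) \<partial>heis_prod_haar m n)
      = (\<integral>\<^sup>+ x. (\<Prod>i=1..m. ennreal (shell_weight (n i) (1 / b) b (x i))) \<partial>heis_prod_haar m n)"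
    by (intro nn_integral_cong) (simp add: gq prod_ennreal shell_weight_nonneg)
  also have "\<dots> = (\<Prod>i=1..m. \<integral>\<^sup>+ x. ennreal (shell_weight (n i) (1 / b) b x) \<partial>heis_haar (n i))"
    by (intro product_sigma_finite.product_nn_integral_prod product_sigma_finite_heis_haar meas) simp
  \<comment> \<open>Each of the \<open>m\<close> shell integrals doubles, which supplies
    \<open>K = 2 ^ m\<close> for the general estimate.\<close>
  also have "\<dots> = 2 ^ m * ennreal N"
    unfolding N_eq shell_weight_integral_double[OF b] prod.distrib by simp
  also have "\<dots> = ennreal (2 ^ m * N)"
    using N_pos by (simp add: ennreal_mult ennreal_power[symmetric])
  finally have int_all: "(\<integral>\<^sup>+ x. ennreal (g x powr q) \<partial>heis_prod_haar m n) \<le> ennreal (2 ^ m * N)"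
    by (rule eq_refl)
  have "(\<integral>\<^sup>+ t. ennreal (w t * \<phi> t) * indicator E t \<partial>completion (cube_measure m))
      \<le> ennreal (C * (2 ^ m) powr (1 / enn2real p))"
  proof (rule nn_integral_le_if_Lp_bounded[where g = g and S = S and N = N])
    show "\<phi> \<in> borel_measurable (completion (cube_measure m))"
      using \<phi> by (simp only: cube_lebesgue_def)
    show "0 \<le> \<phi> t" if "t \<in> space (cube_measure m)" for t
      using that \<phi>0[of t] by (simp only: cube_lebesgue_def space_completion)
    show "Lp_norm (completion (heis_prod_haar m n)) p (hardy \<phi> f)
        \<le> ennreal C * Lp_norm (completion (heis_prod_haar m n)) p (\<lambda>x. ennreal (f x))"
      if "f \<in> nonneg_Lp (completion (heis_prod_haar m n)) p" for f
      using that C(2)[of f] by (simp only: heis_prod_lebesgue_def weighted_hardy_eq)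
  qed (rule p g_meas E_meas S_meas w_meas g0 w0 homogeneous N_pos
      int_S[unfolded q_def] int_all[unfolded q_def] C(1) | assumption | simp)+
  then show ?thesis
    by (simp only: w_def E_def cube_lebesgue_def)
qed

text \<open>The bound on the truncated integrals is independent of the truncation, so monotone
  convergence carries it over to the cube. The truncated sets exhaust the cube up to the null set of
  points with a zero coordinate.\<close>

lemma weight_integral_le_if_Lp_bounded:
  assumes p: "1 \<le> p" "p \<noteq> \<infinity>"
    and \<phi>: "\<phi> \<in> borel_measurable (cube_lebesgue m)"
    and \<phi>0: "\<And>t. t \<in> space (cube_lebesgue m) \<Longrightarrow> 0 \<le> \<phi> t"
    and C: "0 \<le> C" "\<And>f. f \<in> nonneg_Lp (heis_prod_lebesgue m n) p \<Longrightarrow>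
      Lp_norm (heis_prod_lebesgue m n) p (weighted_hardy m n \<phi> f)
        \<le> ennreal C * Lp_norm (heis_prod_lebesgue m n) p (\<lambda>x. ennreal (f x))"
  shows "(\<integral>\<^sup>+ t. ennreal ((\<Prod>i=1..m. t i powr (- hdim_quotient (n i) p)) * \<phi> t) \<partial>cube_lebesgue m)
    \<le> ennreal (C * (2 ^ m) powr (1 / enn2real p))"
proof -
  define h where "h t = ennreal ((\<Prod>i=1..m. t i powr (- hdim_quotient (n i) p)) * \<phi> t)" for t
  \<comment> \<open>Truncation with \<open>b = k + 2\<close>, which exceeds 1 already for
    \<open>k = 0\<close>.\<close>
  define E where "E k = {t \<in> space (cube_measure m). \<forall>i\<in>{1..m}. 1 / real (k + 2) \<le> t i}" for k
  have comp: "(\<lambda>t. t i) \<in> borel_measurable (cube_lebesgue m)" if "i \<in> {1..m}" for i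
    unfolding cube_lebesgue_def by (intro measurable_completion measurable_cube_component that)
  have h [measurable]: "h \<in> borel_measurable (cube_lebesgue m)"
    unfolding h_def
    by (intro measurable_compose[OF _ measurable_ennreal] borel_measurable_times borel_measurable_prod
        powr_real_measurable comp borel_measurable_const \<phi>)
  have E [measurable]: "E k \<in> sets (cube_lebesgue m)" for k
  proof -
    have "E k = {t \<in> space (cube_lebesgue m). \<forall>i\<in>{1..m}. 1 / real (k + 2) \<le> t i}"
      by (simp only: E_def cube_lebesgue_def space_completion)
    also have "\<dots> \<in> sets (cube_lebesgue m)"
      by (intro sets.sets_Collect_finite_All borel_measurable_le comp borel_measurable_const) auto
    finally show ?thesis .
  qed
  have inc: "incseq (\<lambda>k t. h t * indicator (E k) t)"
  proof (intro incseq_SucI le_funI mult_left_mono)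
    fix k t
    have "1 / real (Suc k + 2) \<le> 1 / real (k + 2)" by (intro divide_left_mono) auto
    then have "E k \<subseteq> E (Suc k)" unfolding E_def by (auto intro: order_trans)
    then show "indicator (E k) t \<le> (indicator (E (Suc k)) t :: ennreal)"
      by (auto simp: indicator_def)
  qed simp
  have "(\<integral>\<^sup>+ t. h t \<partial>cube_lebesgue m) = (\<integral>\<^sup>+ t. (SUP k. h t * indicator (E k) t) \<partial>cube_lebesgue m)"
    unfolding cube_lebesgue_def nn_integral_completion
  proof (rule nn_integral_cong_AE, use AE_cube_pos AE_space in eventually_elim)
    case (elim t)
    have "\<exists>k. t \<in> E k"
    proof -
      \<comment> \<open>The inserted 1 keeps the set nonempty for every \<open>m\<close>.\<close>
      define d where "d = Min (insert 1 (t ` {1..m}))"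
      have "0 < d" using elim by (auto simp: d_def)
      then obtain k where k: "inverse (real (Suc k)) < d"
        using reals_Archimedean by blast
      have "1 / real (k + 2) \<le> inverse (real (Suc k))" by (simp add: field_simps)
      with k have "1 / real (k + 2) \<le> d" by linarith
      moreover have "d \<le> t i" if "i \<in> {1..m}" for i
        unfolding d_def using that by (intro Min_le) auto
      ultimately have "t \<in> E k" using elim unfolding E_def by fastforce
      then show ?thesis ..
    qed
    then obtain k where "t \<in> E k" ..
    \<comment> \<open>Every term is either 0 or \<open>h t\<close>, and the value \<open>h t\<close>
      is attained at the index \<open>k\<close>.\<close>
    then show ?case
      by (intro antisym SUP_upper2[of k] SUP_least) (auto simp: indicator_def)
  qed
  also have "\<dots> = (SUP k. \<integral>\<^sup>+ t. h t * indicator (E k) t \<partial>cube_lebesgue m)"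
    using inc by (intro nn_integral_monotone_convergence_SUP) measurable
  also have "\<dots> \<le> ennreal (C * (2 ^ m) powr (1 / enn2real p))"
  proof (rule SUP_least)
    fix k
    show "(\<integral>\<^sup>+ t. h t * indicator (E k) t \<partial>cube_lebesgue m) \<le> ennreal (C * (2 ^ m) powr (1 / enn2real p))"
      unfolding h_def E_def by (intro truncated_weight_integral_le p \<phi> \<phi>0 C) auto
  qed
  finally show ?thesis unfolding h_def .
qed

theorem theorem2:
  fixes p :: ennreal
    and m :: nat
    and n :: "nat \<Rightarrow> nat"
    and \<phi> :: "(nat \<Rightarrow> real) \<Rightarrow> real"
  assumes "1 \<le> p"
    and "1 \<le> m"
    and "\<And>i. i \<in> {1..m} \<Longrightarrow> 1 \<le> n i"
    and "\<phi> \<in> borel_measurable (cube_lebesgue m)"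
    and "\<And>t. t \<in> space (cube_lebesgue m) \<Longrightarrow> 0 \<le> \<phi> t"
  shows "Lp_bounded (heis_prod_lebesgue m n) p (weighted_hardy m n \<phi>) \<longleftrightarrow>
    (\<integral>\<^sup>+ t. ennreal ((\<Prod>i=1..m. t i powr (- hdim_quotient (n i) p)) * \<phi> t) \<partial>cube_lebesgue m) < \<infinity>"
    (is "_ \<longleftrightarrow> ?I < \<infinity>")
proof
  assume "Lp_bounded (heis_prod_lebesgue m n) p (weighted_hardy m n \<phi>)"
  then obtain C where C: "0 \<le> C" "\<And>f. f \<in> nonneg_Lp (heis_prod_lebesgue m n) p \<Longrightarrow>
      Lp_norm (heis_prod_lebesgue m n) p (weighted_hardy m n \<phi> f)
        \<le> ennreal C * Lp_norm (heis_prod_lebesgue m n) p (\<lambda>x. ennreal (f x))"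
    unfolding Lp_bounded_def by blast
  show "?I < \<infinity>"
  proof (cases "p = \<infinity>")
    case True
    \<comment> \<open>All exponents are 0 here, but \<open>0 powr 0 = 0\<close>, so the integrands
      agree only where no coordinate vanishes.\<close>
    have "?I = (\<integral>\<^sup>+ t. ennreal (\<phi> t) \<partial>cube_lebesgue m)"
      unfolding cube_lebesgue_def nn_integral_completion
    proof (rule nn_integral_cong_AE, use AE_cube_pos in eventually_elim)
      case (elim t)
      then have "(\<Prod>i=1..m. t i powr (- hdim_quotient (n i) p)) = 1"
        using True by (intro prod.neutral) (auto simp: hdim_quotient_def)
      then show ?case by simp
    qed
    also have "\<dots> \<le> ennreal C"
      using C(2) True by (intro weight_integral_le_if_Lp_bounded_infinity) simp
    finally show ?thesis by (simp add: le_less_trans)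
  next
    case False
    have "?I \<le> ennreal (C * (2 ^ m) powr (1 / enn2real p))"
      by (rule weight_integral_le_if_Lp_bounded[OF assms(1) False assms(4,5) C])
    then show ?thesis by (simp add: le_less_trans)
  qed
next
  interpret dilation_family "heis_prod_haar m n" "cube_measure m" "prod_dilation m n" "dilation_jacobian m n"
    by (rule dilation_family_heis)
  assume fin: "?I < \<infinity>"
  \<comment> \<open>Translates the finiteness hypothesis into the form required by
    \<open>Lp_bounded_hardyI\<close>: the integrands agree almost everywhere, and completing the
    measure does not change the integral.\<close>
  have "(\<integral>\<^sup>+ t. ennreal (dilation_jacobian m n t powr (- (if p = \<infinity> then 0 else 1 / enn2real p)) * \<phi> t)
      \<partial>cube_measure m) = ?I"
    unfolding cube_lebesgue_def nn_integral_completion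
  proof (rule nn_integral_cong_AE, use AE_cube_pos in eventually_elim)
    case (elim t)
    then show ?case by (subst dilation_jacobian_powr) auto
  qed
  then have "Lp_bounded (completion (heis_prod_haar m n)) p (hardy \<phi>)"
    using fin assms(1,4,5)
    by (intro Lp_bounded_hardyI) (simp_all only: cube_lebesgue_def space_completion)
  then show "Lp_bounded (heis_prod_lebesgue m n) p (weighted_hardy m n \<phi>)"
    by (simp only: heis_prod_lebesgue_def weighted_hardy_eq)
qed

end
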